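(* Let $\mathfrak{H}$ be a finite-dimensional Hilbert space, let $\mathcal{E}$ be an error basis on $\mathfrak{H}$, and let $\mathcal{M}:\mathfrak{H}\leadsto\mathfrak{H}$ be a quantum channel. Relative to $\mathcal{E}$, the circuit tensor $\mathbf{C}(\mathcal{M})$ and the process matrix $\chi$ of $\mathcal{M}$ satisfy $$\mathbf{C}(\mathcal{M}) = \dim(\mathfrak{H})\,\Psi(\chi),$$ where $\Psi$ is the quantum MacWilliams transform of the error basis $\mathcal{E}$.
   Context: Error basis: an error basis on a Hilbert space $\mathfrak{H}$ is a basis $\mathcal{E}$ of $L(\mathfrak{H})$ consisting of unitary operators, such that $I\in\mathcal{E}$; $\mathrm{Tr}(E^\dagger F)=0$ for distinct $E,F\in\mathcal{E}$; and $EF=\omega(E,F)FE$ for all $E,F\in\mathcal{E}$, where $\omega(E,F)\in\mathbb{C}$ satisfies $\omega(E,F)^r=1$ for some fixed $r$. $\mathcal{M}:\mathfrak{H}\leadsto\mathfrak{H}$ denotes a quantum channel acting on operators on $\mathfrak{H}$, $\mathcal{M}(\rho)=\sum_jA_j\rho A_j^\dagger$ with Kraus operators $A_j$. Matrix units: $e^{E}_{E'}$ is the matrix indexed by elements of $\mathcal{E}$ with $1$ in its $(E,E')$ entry and $0$ elsewhere. Circuit tensor: fix an orthonormal basis $\{|x\rangle\}$ of $\mathfrak{H}$ (with respect to which the complex conjugate $E^*$ is taken). For $A\in L(\mathfrak{H})$ let $|T_A\rangle=\frac{1}{\sqrt{\dim\mathfrak{H}}}\sum_x|x\rangle\otimes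 A|x\rangle$. The Choi matrix of $\mathcal{M}$ is $T_{\mathcal{M}}=\sum_j|T_{A_j}\rangle\langle T_{A_j}|$ (independent of the choice of Kraus operators), and the circuit tensor is $\mathbf{C}(\mathcal{M})=\sum_{E,E'\in\mathcal{E}}\mathrm{Tr}((E^*\otimes E')T_{\mathcal{M}})\,e^E_{E'}$. Process matrix: the process matrix of $\mathcal{M}$ is the (unique) matrix $\chi=\sum_{E,E'}\chi^E_{E'}e^E_{E'}$ defined implicitly by $\mathcal{M}(\rho)=\sum_{E,E'\in\mathcal{E}}\chi^E_{E'}\,(E')^\dagger\rho E$ for all $\rho$. Quantum MacWilliams transform: $\Psi$ is the linear operator on matrices indexed by $\mathcal{E}$ given by $$\Psi(e^E_{E'})=\frac{1}{\dim(\mathfrak{H})^2}\sum_{F,F'\in\mathcal{E}}\mathrm{Tr}(F^\dagger E F'(E')^\dagger)\,e^F_{F'}.$$ *)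

theory Defs
  imports Complex_Main "HOL-Library.Function_Algebras"
begin

text \<open>
  A finite-dimensional complex Hilbert space is a complex vector space \<open>'h\<close> with a positive
  definite Hermitian form \<open>ip\<close>, linear in its second argument (the convention behind
  \<open>\<langle>u|v\<rangle>\<close>), together with a chosen orthonormal basis.  Completeness is automatic in finite
  dimension.
\<close>

locale fd_hilbert = finite_dimensional_vector_space scale Basis
  for scale :: "complex \<Rightarrow> 'h::ab_group_add \<Rightarrow> 'h" and Basis :: "'h set" +
  fixes ip :: "'h \<Rightarrow> 'h \<Rightarrow> complex"
  assumes ip_add_right: "ip u (v + w) = ip u v + ip u w"
    and ip_scale_right: "ip u (scale c v) = c * ip u v"
    and ip_commute: "ip u v = cnj (ip v u)"
    and ip_pos: "v \<noteq> 0 \<Longrightarrow> 0 < Re (ip v v)"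
    and orthonormal: "u \<in> Basis \<Longrightarrow> v \<in> Basis \<Longrightarrow> ip u v = (if u = v then 1 else 0)"

text \<open>
  For an arbitrary index type, matrices are functions of two indices; a matrix indexed by a set is
  one that vanishes off that set.  Addition and finite sums of operators, vectors and matrices are
  the pointwise ones of \<open>HOL-Library.Function_Algebras\<close>.
\<close>

definition mat_scale :: "complex \<Rightarrow> ('i \<Rightarrow> 'i \<Rightarrow> complex) \<Rightarrow> 'i \<Rightarrow> 'i \<Rightarrow> complex"
  where "mat_scale c X = (\<lambda>i j. c * X i j)"

definition mat_unit :: "'i \<Rightarrow> 'i \<Rightarrow> 'i \<Rightarrow> 'i \<Rightarrow> complex"
  where "mat_unit i j = (\<lambda>k l. if k = i \<and> l = j then 1 else 0)"

context fd_hilbert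
begin

abbreviation hdim :: nat
  where "hdim \<equiv> dim UNIV"

definition op_scale :: "complex \<Rightarrow> ('h \<Rightarrow> 'h) \<Rightarrow> 'h \<Rightarrow> 'h"
  where "op_scale c A = (\<lambda>v. scale c (A v))"

sublocale op: vector_space op_scale
  by unfold_locales
    (auto simp: op_scale_def fun_eq_iff scale_right_distrib scale_left_distrib)

definition ops :: "('h \<Rightarrow> 'h) set"
  where "ops = {A. Vector_Spaces.linear scale scale A}"

definition adj :: "('h \<Rightarrow> 'h) \<Rightarrow> 'h \<Rightarrow> 'h"
  where "adj A = (THE B. B \<in> ops \<and> (\<forall>u v. ip u (A v) = ip (B u) v))"

definition tr :: "('h \<Rightarrow> 'h) \<Rightarrow> complex"
  where "tr A = (\<Sum>x\<in>Basis. ip x (A x))"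

text \<open>The entrywise complex conjugate \<open>A\<^sup>*\<close> with respect to the chosen basis.\<close>

definition conj_op :: "('h \<Rightarrow> 'h) \<Rightarrow> 'h \<Rightarrow> 'h"
  where "conj_op A = (\<lambda>v. \<Sum>x\<in>Basis. scale (\<Sum>y\<in>Basis. cnj (ip x (A y)) * ip y v) x)"

definition unitary :: "('h \<Rightarrow> 'h) \<Rightarrow> bool"
  where "unitary U \<longleftrightarrow> U \<in> ops \<and> adj U \<circ> U = id \<and> U \<circ> adj U = id"

definition error_basis :: "('h \<Rightarrow> 'h) set \<Rightarrow> bool"
  where "error_basis \<E> \<longleftrightarrow>
    op.independent \<E> \<and> op.span \<E> = ops \<and>
    (\<forall>E\<in>\<E>. unitary E) \<and>
    id \<in> \<E> \<and>
    (\<forall>E\<in>\<E>. \<forall>F\<in>\<E>. E \<noteq> F \<longrightarrow> tr (adj E \<circ> F) = 0) \<and>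
    (\<exists>r::nat. r > 0 \<and> (\<exists>\<omega>. \<forall>E\<in>\<E>. \<forall>F\<in>\<E>.
        \<omega> E F ^ r = 1 \<and> E \<circ> F = op_scale (\<omega> E F) (F \<circ> E)))"

definition kraus_rep ::
    "(('h \<Rightarrow> 'h) \<Rightarrow> 'h \<Rightarrow> 'h) \<Rightarrow> nat \<Rightarrow> (nat \<Rightarrow> 'h \<Rightarrow> 'h) \<Rightarrow> bool"
  where "kraus_rep \<M> n A \<longleftrightarrow>
    (\<forall>j<n. A j \<in> ops) \<and> (\<forall>\<rho>\<in>ops. \<M> \<rho> = (\<Sum>j<n. A j \<circ> \<rho> \<circ> adj (A j)))"

text \<open>
  A channel is any map in Kraus form.  Trace preservation is not imposed; trace-preserving
  channels are a special case.
\<close>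

definition quantum_channel :: "(('h \<Rightarrow> 'h) \<Rightarrow> 'h \<Rightarrow> 'h) \<Rightarrow> bool"
  where "quantum_channel \<M> \<longleftrightarrow> (\<exists>n A. kraus_rep \<M> n A)"

text \<open>
  The tensor square of the Hilbert space is represented by coordinates in the product basis, i.e.
  by functions on pairs that vanish off \<open>Basis \<times> Basis\<close>, and its operators by matrices indexed by
  such pairs.
\<close>

definition tensor_vec :: "'h \<Rightarrow> 'h \<Rightarrow> 'h \<times> 'h \<Rightarrow> complex"
  where "tensor_vec u v =
    (\<lambda>(x, y). if x \<in> Basis \<and> y \<in> Basis then ip x u * ip y v else 0)"

definition tensor_op :: "('h \<Rightarrow> 'h) \<Rightarrow> ('h \<Rightarrow> 'h) \<Rightarrow> 'h \<times> 'h \<Rightarrow> 'h \<times> 'h \<Rightarrow> complex"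
  where "tensor_op A B = (\<lambda>(x, y) (x', y').
    if x \<in> Basis \<and> y \<in> Basis \<and> x' \<in> Basis \<and> y' \<in> Basis
    then ip x (A x') * ip y (B y') else 0)"

text \<open>The trace of a product of two operators on the tensor square.\<close>

definition tensor_tr_prod ::
    "('h \<times> 'h \<Rightarrow> 'h \<times> 'h \<Rightarrow> complex) \<Rightarrow> ('h \<times> 'h \<Rightarrow> 'h \<times> 'h \<Rightarrow> complex) \<Rightarrow> complex"
  where "tensor_tr_prod X Y = (\<Sum>p\<in>Basis \<times> Basis. \<Sum>q\<in>Basis \<times> Basis. X p q * Y q p)"

definition T_vec :: "('h \<Rightarrow> 'h) \<Rightarrow> 'h \<times> 'h \<Rightarrow> complex"
  where "T_vec A =
    (\<lambda>p. complex_of_real (1 / sqrt (real hdim)) * (\<Sum>x\<in>Basis. tensor_vec x (A x) p))"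

text \<open>The Choi matrix does not depend on the Kraus operators, so the description is proper.\<close>

definition choi ::
    "(('h \<Rightarrow> 'h) \<Rightarrow> 'h \<Rightarrow> 'h) \<Rightarrow> 'h \<times> 'h \<Rightarrow> 'h \<times> 'h \<Rightarrow> complex"
  where "choi \<M> = (THE T. \<exists>n A. kraus_rep \<M> n A \<and>
    T = (\<Sum>j<n. (\<lambda>p q. T_vec (A j) p * cnj (T_vec (A j) q))))"

definition circuit_tensor ::
    "('h \<Rightarrow> 'h) set \<Rightarrow> (('h \<Rightarrow> 'h) \<Rightarrow> 'h \<Rightarrow> 'h) \<Rightarrow> ('h \<Rightarrow> 'h) \<Rightarrow> ('h \<Rightarrow> 'h) \<Rightarrow> complex"
  where "circuit_tensor \<E> \<M> =
    (\<Sum>E\<in>\<E>. \<Sum>E'\<in>\<E>.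
      mat_scale (tensor_tr_prod (tensor_op (conj_op E) E') (choi \<M>)) (mat_unit E E'))"

definition process_matrix ::
    "('h \<Rightarrow> 'h) set \<Rightarrow> (('h \<Rightarrow> 'h) \<Rightarrow> 'h \<Rightarrow> 'h) \<Rightarrow> ('h \<Rightarrow> 'h) \<Rightarrow> ('h \<Rightarrow> 'h) \<Rightarrow> complex"
  where "process_matrix \<E> \<M> = (THE \<chi>.
    (\<forall>E E'. \<not> (E \<in> \<E> \<and> E' \<in> \<E>) \<longrightarrow> \<chi> E E' = 0) \<and>
    (\<forall>\<rho>\<in>ops. \<M> \<rho> = (\<Sum>E\<in>\<E>. \<Sum>E'\<in>\<E>. op_scale (\<chi> E E') (adj E' \<circ> \<rho> \<circ> E))))"

definition macwilliams_unit ::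
    "('h \<Rightarrow> 'h) set \<Rightarrow> ('h \<Rightarrow> 'h) \<Rightarrow> ('h \<Rightarrow> 'h) \<Rightarrow> ('h \<Rightarrow> 'h) \<Rightarrow> ('h \<Rightarrow> 'h) \<Rightarrow> complex"
  where "macwilliams_unit \<E> E E' =
    mat_scale (1 / of_nat hdim ^ 2)
      (\<Sum>F\<in>\<E>. \<Sum>F'\<in>\<E>. mat_scale (tr (adj F \<circ> E \<circ> F' \<circ> adj E')) (mat_unit F F'))"

text \<open>The linear extension from matrix units to all matrices indexed by \<open>\<E>\<close>.\<close>

definition macwilliams ::
    "('h \<Rightarrow> 'h) set \<Rightarrow> (('h \<Rightarrow> 'h) \<Rightarrow> ('h \<Rightarrow> 'h) \<Rightarrow> complex)
      \<Rightarrow> ('h \<Rightarrow> 'h) \<Rightarrow> ('h \<Rightarrow> 'h) \<Rightarrow> complex"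
  where "macwilliams \<E> X = (\<Sum>E\<in>\<E>. \<Sum>E'\<in>\<E>. mat_scale (X E E') (macwilliams_unit \<E> E E'))"

end

end

theory Submission
  imports Defs
begin

text \<open>
  Cyclicity of the trace turns the circuit tensor into \<open>C\<^sub>F\<^sub>F\<^sub>' = Tr(F' \<M>(F\<^sup>\<dagger>)) / d\<close>, with
  \<open>d = dim \<HH>\<close>.  Expanding \<open>\<M>(F\<^sup>\<dagger>)\<close> by the process matrix gives
  \<open>\<Sum> \<chi>\<^sub>E\<^sub>E\<^sub>' Tr(F\<^sup>\<dagger> E F' E'\<^sup>\<dagger>) / d\<close>, which is \<open>d\<close> times the transform of \<open>\<chi>\<close>.  The Choi matrix is
  well defined because its entries are those of \<open>\<M>(|x\<rangle>\<langle>x'|)\<close>, and the process matrix is because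
  an error basis and its adjoints are both bases of the operator space.
\<close>

section \<open>Entries of sums of matrix units\<close>

lemma sum_fun_apply: "(\<Sum>i\<in>I. f i) x = (\<Sum>i\<in>I. f i x)"
  for f :: "'i \<Rightarrow> 'a \<Rightarrow> 'b::comm_monoid_add"
  by (induction I rule: infinite_finite_induct) auto

lemma sum_mat_scale_mat_unit:
  assumes "finite I"
  shows "(\<Sum>i\<in>I. \<Sum>j\<in>I. mat_scale (f i j) (mat_unit i j)) k l =
    (if k \<in> I \<and> l \<in> I then f k l else 0)"
proof -
  have "(\<Sum>i\<in>I. \<Sum>j\<in>I. mat_scale (f i j) (mat_unit i j)) k l =
      (\<Sum>i\<in>I. if i = k then (\<Sum>j\<in>I. if j = l then f i j else 0) else 0)"
    unfolding sum_fun_apply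
    by (intro sum.cong refl) (auto simp: mat_scale_def mat_unit_def intro!: sum.cong sum.neutral)
  also have "\<dots> = (if k \<in> I \<and> l \<in> I then f k l else 0)"
    using assms by simp
  finally show ?thesis .
qed

context fd_hilbert
begin

section \<open>Inner product and coordinates in the orthonormal basis\<close>

lemma ip_0_right [simp]: "ip u 0 = 0"
  using ip_scale_right[of u 0 0] by simp

lemma ip_sum_right: "ip u (\<Sum>i\<in>I. f i) = (\<Sum>i\<in>I. ip u (f i))"
  by (induction I rule: infinite_finite_induct) (auto simp: ip_add_right)

lemma ip_add_left: "ip (u + v) w = ip u w + ip v w"
  by (subst (1 2 3) ip_commute) (simp add: ip_add_right)

lemma ip_scale_left: "ip (scale c u) v = cnj c * ip u v"
  by (subst (1 2) ip_commute) (simp add: ip_scale_right)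

lemma ip_0_left [simp]: "ip 0 u = 0"
  by (subst ip_commute) simp

lemma ip_sum_left: "ip (\<Sum>i\<in>I. f i) v = (\<Sum>i\<in>I. ip (f i) v)"
  by (induction I rule: infinite_finite_induct) (auto simp: ip_add_left)

lemma basis_expansion: "v = (\<Sum>x\<in>Basis. scale (ip x v) x)"
proof -
  have "v \<in> span Basis"
    using span_Basis by simp
  then obtain c where c: "v = (\<Sum>x\<in>Basis. scale (c x) x)"
    unfolding span_finite[OF finite_Basis] by auto
  have "ip x v = c x" if "x \<in> Basis" for x
  proof -
    have "ip x v = (\<Sum>y\<in>Basis. if y = x then c y else 0)"
      unfolding c ip_sum_right
      by (intro sum.cong refl) (use that in \<open>auto simp: ip_scale_right orthonormal\<close>)
    also have "\<dots> = c x"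
      using that finite_Basis by simp
    finally show ?thesis .
  qed
  then show ?thesis
    by (subst c) (simp cong: sum.cong)
qed

lemma parseval: "ip u v = (\<Sum>x\<in>Basis. ip u x * ip x v)"
  by (subst basis_expansion[of v]) (simp add: ip_sum_right ip_scale_right mult.commute)

lemma vec_eqI:
  assumes "\<And>x. x \<in> Basis \<Longrightarrow> ip x u = ip x v"
  shows "u = v"
  by (subst basis_expansion[of u], subst basis_expansion[of v]) (simp add: assms cong: sum.cong)

section \<open>Linear operators and their adjoints\<close>

lemma opsI:
  assumes "\<And>u v. A (u + v) = A u + A v" "\<And>c v. A (scale c v) = scale c (A v)"
  shows "A \<in> ops"
  unfolding ops_def mem_Collect_eq using assms by unfold_locales auto

lemma ops_add: "A \<in> ops \<Longrightarrow> A (u + v) = A u + A v"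
  unfolding ops_def mem_Collect_eq by (simp add: linear_iff_module_hom module_hom.add)

lemma ops_scale: "A \<in> ops \<Longrightarrow> A (scale c v) = scale c (A v)"
  unfolding ops_def mem_Collect_eq by (simp add: linear_iff_module_hom module_hom.scale)

lemma ops_sum: "A \<in> ops \<Longrightarrow> A (\<Sum>i\<in>I. f i) = (\<Sum>i\<in>I. A (f i))"
  unfolding ops_def mem_Collect_eq by (simp add: linear_iff_module_hom module_hom.sum)

lemma ops_comp: "A \<in> ops \<Longrightarrow> B \<in> ops \<Longrightarrow> A \<circ> B \<in> ops"
  by (rule opsI) (auto simp: ops_add ops_scale)

lemma op_scale_apply: "op_scale c A v = scale c (A v)"
  by (simp add: op_scale_def)

lemma ops_eqI:
  assumes "A \<in> ops" "B \<in> ops"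
    and "\<And>x y. x \<in> Basis \<Longrightarrow> y \<in> Basis \<Longrightarrow> ip x (A y) = ip x (B y)"
  shows "A = B"
proof
  fix v
  have "A y = B y" if "y \<in> Basis" for y
    using assms(3) that by (intro vec_eqI)
  then show "A v = B v"
    by (subst (1 2) basis_expansion[of v])
      (simp add: ops_sum ops_scale assms(1,2) cong: sum.cong)
qed

lemma
  assumes "A \<in> ops"
  shows adj_ops: "adj A \<in> ops" and ip_adj: "ip (adj A u) v = ip u (A v)"
proof -
  \<comment> \<open>The Riesz vector of the functional \<open>v \<mapsto> ip u (A v)\<close>: its
    coordinate at \<open>x\<close> must be the conjugate of \<open>ip u (A x)\<close>, which is
    \<open>ip (A x) u\<close>.\<close>
  let ?B = "\<lambda>u. \<Sum>x\<in>Basis. scale (ip (A x) u) x"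
  have B: "?B \<in> ops"
    by (rule opsI)
      (auto simp: ip_add_right ip_scale_right scale_left_distrib sum.distrib scale_sum_right)
  have ip_B: "ip u (A v) = ip (?B u) v" for u v
  proof -
    have "ip u (A v) = ip u (A (\<Sum>x\<in>Basis. scale (ip x v) x))"
      by (simp flip: basis_expansion)
    also have "\<dots> = (\<Sum>x\<in>Basis. ip u (A x) * ip x v)"
      by (simp add: ops_sum ops_scale assms ip_sum_right ip_scale_right mult.commute)
    also have "\<dots> = ip (?B u) v"
      by (simp add: ip_sum_left ip_scale_left ip_commute[of u])
    finally show ?thesis .
  qed
  have "\<exists>!B. B \<in> ops \<and> (\<forall>u v. ip u (A v) = ip (B u) v)"
  proof (rule ex1I)
    show "?B \<in> ops \<and> (\<forall>u v. ip u (A v) = ip (?B u) v)"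
      using B ip_B by blast
    fix C assume C: "C \<in> ops \<and> (\<forall>u v. ip u (A v) = ip (C u) v)"
    have "ip (C y) x = ip (?B y) x" for x y
      using C ip_B by metis
    then show "C = ?B"
      using C B by (intro ops_eqI) (metis ip_commute)+
  qed
  then have "adj A \<in> ops \<and> (\<forall>u v. ip u (A v) = ip (adj A u) v)"
    unfolding adj_def by (rule theI')
  then show "adj A \<in> ops" "ip (adj A u) v = ip u (A v)"
    by simp_all
qed

lemma ip_adj_right:
  assumes "A \<in> ops"
  shows "ip u (adj A v) = ip (A u) v"
  by (metis assms ip_adj ip_commute)

text \<open>Matrix multiplication: once \<open>A\<close> is moved to the left slot as its adjoint,
  the resolution of the identity fits between it and \<open>B v\<close>.\<close>

lemma ip_comp:
  assumes "A \<in> ops"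
  shows "ip u (A (B v)) = (\<Sum>y\<in>Basis. ip u (A y) * ip y (B v))"
proof -
  have "ip u (A (B v)) = ip (adj A u) (B v)"
    using assms by (simp add: ip_adj)
  also have "\<dots> = (\<Sum>y\<in>Basis. ip (adj A u) y * ip y (B v))"
    by (rule parseval)
  finally show ?thesis
    using assms by (simp add: ip_adj)
qed

section \<open>The trace\<close>

lemma tr_comp:
  assumes "A \<in> ops"
  shows "tr (A \<circ> B) = (\<Sum>x\<in>Basis. \<Sum>y\<in>Basis. ip x (A y) * ip y (B x))"
  using assms by (simp add: tr_def ip_comp)

lemma tr_cyclic:
  assumes "A \<in> ops" "B \<in> ops"
  shows "tr (A \<circ> B) = tr (B \<circ> A)"
  unfolding tr_comp[OF assms(1)] tr_comp[OF assms(2)]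
  by (subst sum.swap) (simp add: mult.commute)

lemma tr_sum: "tr (\<Sum>i\<in>I. f i) = (\<Sum>i\<in>I. tr (f i))"
  unfolding tr_def sum_fun_apply ip_sum_right by (rule sum.swap)

lemma tr_op_scale: "tr (op_scale c A) = c * tr A"
  by (simp add: tr_def op_scale_apply ip_scale_right sum_distrib_left)

lemma comp_sum_left: "A \<in> ops \<Longrightarrow> A \<circ> (\<Sum>i\<in>I. f i) = (\<Sum>i\<in>I. A \<circ> f i)"
  by (auto simp: fun_eq_iff sum_fun_apply ops_sum)

lemma comp_op_scale: "A \<in> ops \<Longrightarrow> A \<circ> op_scale c B = op_scale c (A \<circ> B)"
  by (auto simp: fun_eq_iff op_scale_apply ops_scale)

section \<open>Rank-one operators and finiteness of independent sets\<close>

definition ketbra :: "'h \<Rightarrow> 'h \<Rightarrow> 'h \<Rightarrow> 'h"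
  where "ketbra u v = (\<lambda>w. scale (ip v w) u)"

lemma ketbra_ops: "ketbra u v \<in> ops"
  by (rule opsI) (auto simp: ketbra_def ip_add_right ip_scale_right scale_left_distrib)

text \<open>A rank-one operator in the middle decouples the two outer factors. Both the Choi entries
  and the uniqueness of the process matrix rest on this.\<close>

lemma ip_ketbra: "A \<in> ops \<Longrightarrow> ip x ((A \<circ> ketbra u v \<circ> B) y) = ip x (A u) * ip v (B y)"
  by (simp add: ketbra_def ops_scale ip_scale_right)

lemma ops_subset_span_ketbra: "ops \<subseteq> op.span ((\<lambda>(x, y). ketbra x y) ` (Basis \<times> Basis))"
proof
  fix A assume A: "A \<in> ops"
  have "A = (\<Sum>x\<in>Basis. \<Sum>y\<in>Basis. op_scale (ip x (A y)) (ketbra x y))"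
  proof
    fix v
    have "A v = (\<Sum>x\<in>Basis. scale (ip x (A v)) x)"
      by (rule basis_expansion)
    also have "\<dots> = (\<Sum>x\<in>Basis. scale (\<Sum>y\<in>Basis. ip x (A y) * ip y v) x)"
      by (intro sum.cong refl arg_cong2[where f = scale] ip_comp[OF A, where B = id, unfolded id_apply])
    finally show "A v = (\<Sum>x\<in>Basis. \<Sum>y\<in>Basis. op_scale (ip x (A y)) (ketbra x y)) v"
      by (simp add: sum_fun_apply op_scale_apply ketbra_def scale_sum_left)
  qed
  also have "\<dots> \<in> op.span ((\<lambda>(x, y). ketbra x y) ` (Basis \<times> Basis))"
    by (intro op.span_sum op.span_scale op.span_base) auto
  finally show "A \<in> op.span ((\<lambda>(x, y). ketbra x y) ` (Basis \<times> Basis))" .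
qed

text \<open>The definition of an error basis does not state finiteness, while a sum over an infinite
  set would default to 0. The rank-one operators on basis vectors form a finite spanning set, which
  bounds every independent set.\<close>

lemma independent_ops_finite:
  assumes "op.independent \<E>" "\<E> \<subseteq> ops"
  shows "finite \<E>"
proof (rule conjunct1[OF op.independent_span_bound])
  show "finite ((\<lambda>(x, y). ketbra x y) ` (Basis \<times> Basis))"
    using finite_Basis by simp
qed (use assms ops_subset_span_ketbra in auto)

section \<open>Adjoints of linear combinations\<close>

lemma sum_op_scale_ops: "(\<And>i. i \<in> I \<Longrightarrow> f i \<in> ops) \<Longrightarrow> (\<Sum>i\<in>I. op_scale (c i) (f i)) \<in> ops"
  by (rule opsI)
    (auto simp: sum_fun_apply op_scale_apply ops_add ops_scale scale_right_distrib
      sum.distrib scale_sum_right mult.commute intro!: sum.cong)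

text \<open>Serves to turn an expansion of \<open>adj A\<close> over the error basis into one of
  \<open>A\<close> over the adjoints of its elements.\<close>

lemma adj_sum_op_scale:
  assumes "\<And>i. i \<in> I \<Longrightarrow> f i \<in> ops"
  shows "adj (\<Sum>i\<in>I. op_scale (c i) (f i)) = (\<Sum>i\<in>I. op_scale (cnj (c i)) (adj (f i)))"
proof (rule ops_eqI)
  show "adj (\<Sum>i\<in>I. op_scale (c i) (f i)) \<in> ops"
    "(\<Sum>i\<in>I. op_scale (cnj (c i)) (adj (f i))) \<in> ops"
    using assms by (auto intro!: adj_ops sum_op_scale_ops)
  show "ip x (adj (\<Sum>i\<in>I. op_scale (c i) (f i)) y) =
      ip x ((\<Sum>i\<in>I. op_scale (cnj (c i)) (adj (f i))) y)" for x y
    by (simp add: ip_adj_right sum_op_scale_ops assms sum_fun_apply op_scale_apply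
        ip_sum_left ip_sum_right ip_scale_left ip_scale_right cong: sum.cong)
qed

lemma adj_adj: "A \<in> ops \<Longrightarrow> adj (adj A) = A"
  by (rule ops_eqI) (auto simp: adj_ops ip_adj_right ip_adj)

section \<open>The Choi matrix and the circuit tensor\<close>

lemma ip_conj_op:
  assumes "x \<in> Basis" "y \<in> Basis"
  shows "ip x (conj_op A y) = cnj (ip x (A y))"
proof -
  have "ip x (conj_op A y) =
      (\<Sum>z\<in>Basis. if z = x then (\<Sum>w\<in>Basis. cnj (ip z (A w)) * ip w y) else 0)"
    unfolding conj_op_def ip_sum_right
    by (intro sum.cong refl) (use assms in \<open>auto simp: ip_scale_right orthonormal\<close>)
  also have "\<dots> = (\<Sum>w\<in>Basis. cnj (ip x (A w)) * ip w y)"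
    using assms finite_Basis by simp
  also have "\<dots> = (\<Sum>w\<in>Basis. if w = y then cnj (ip x (A w)) else 0)"
    by (intro sum.cong refl) (use assms in \<open>auto simp: orthonormal\<close>)
  also have "\<dots> = cnj (ip x (A y))"
    using assms finite_Basis by simp
  finally show ?thesis .
qed

lemma T_vec_apply:
  "T_vec A (x, y) = (if x \<in> Basis \<and> y \<in> Basis
    then complex_of_real (1 / sqrt (real hdim)) * ip y (A x) else 0)"
proof (cases "x \<in> Basis \<and> y \<in> Basis")
  case True
  have "(\<Sum>z\<in>Basis. tensor_vec z (A z) (x, y)) = (\<Sum>z\<in>Basis. if z = x then ip y (A z) else 0)"
    by (intro sum.cong refl) (use True in \<open>auto simp: tensor_vec_def orthonormal\<close>)
  also have "\<dots> = ip y (A x)"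
    using True finite_Basis by simp
  finally show ?thesis
    using True by (simp add: T_vec_def)
qed (auto simp: T_vec_def tensor_vec_def)

lemma T_vec_mult_cnj:
  "T_vec A (x, y) * cnj (T_vec A (x', y')) =
    (if x \<in> Basis \<and> y \<in> Basis \<and> x' \<in> Basis \<and> y' \<in> Basis
     then ip y (A x) * cnj (ip y' (A x')) / of_nat hdim else 0)"
proof -
  \<comment> \<open>In dimension 0 both sides are 0, because division by 0 gives 0; no case split is
    needed.\<close>
  have "complex_of_real (1 / sqrt (real hdim)) * complex_of_real (1 / sqrt (real hdim)) =
      1 / of_nat hdim"
    by (simp flip: of_real_mult)
  then show ?thesis
    by (simp add: T_vec_apply mult.assoc mult.left_commute)
qed

text \<open>The right side is, up to the factor \<open>1 / hdim\<close>, a Choi entry computed from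
  the Kraus operators; the left side knows only the channel. Hence the Choi matrix cannot depend on
  the Kraus operators.\<close>

lemma ip_kraus:
  assumes "kraus_rep \<M> n A"
  shows "ip y (\<M> (ketbra x x') y') = (\<Sum>j<n. ip y (A j x) * cnj (ip y' (A j x')))"
proof -
  have "ip y (\<M> (ketbra x x') y') = (\<Sum>j<n. ip y ((A j \<circ> ketbra x x' \<circ> adj (A j)) y'))"
    using assms ketbra_ops unfolding kraus_rep_def by (simp add: sum_fun_apply ip_sum_right)
  also have "\<dots> = (\<Sum>j<n. ip y (A j x) * cnj (ip y' (A j x')))"
    using assms unfolding kraus_rep_def
    by (intro sum.cong refl) (simp add: ip_ketbra ip_adj_right del: o_apply, metis ip_commute)
  finally show ?thesis .
qed

lemma choi_eq:
  assumes "kraus_rep \<M> n A"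
  shows "choi \<M> = (\<Sum>j<n. (\<lambda>p q. T_vec (A j) p * cnj (T_vec (A j) q)))"
  unfolding choi_def
proof (rule the_equality)
  \<comment> \<open>The right side does not mention \<open>A\<close>, so any two candidates for the
    description agree.\<close>
  have entries: "(\<Sum>j<n. (\<lambda>p q. T_vec (A j) p * cnj (T_vec (A j) q))) =
    (\<lambda>(x, y) (x', y'). if x \<in> Basis \<and> y \<in> Basis \<and> x' \<in> Basis \<and> y' \<in> Basis
      then ip y (\<M> (ketbra x x') y') / of_nat hdim else 0)"
    if "kraus_rep \<M> n A" for n A
    by (auto simp: fun_eq_iff sum_fun_apply T_vec_mult_cnj ip_kraus[OF that] sum_divide_distrib)
  fix T
  assume "\<exists>n A. kraus_rep \<M> n A \<and> T = (\<Sum>j<n. (\<lambda>p q. T_vec (A j) p * cnj (T_vec (A j) q)))"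
  then show "T = (\<Sum>j<n. (\<lambda>p q. T_vec (A j) p * cnj (T_vec (A j) q)))"
    using entries entries[OF assms] by auto
qed (use assms in blast)

text \<open>The first tensor factor of \<open>T_vec\<close> labels the input of the Kraus operator.
  Contracting it with the conjugate of \<open>E\<close> therefore feeds \<open>adj E\<close> into
  the channel, since \<open>cnj (ip x (E x'))\<close> is the entry \<open>ip x' (adj E x)\<close>;
  the second factor contributes \<open>F\<close> at the output.\<close>

lemma tensor_tr_prod_choi:
  assumes "kraus_rep \<M> n A" "E \<in> ops" "F \<in> ops"
  shows "tensor_tr_prod (tensor_op (conj_op E) F) (choi \<M>) = tr (F \<circ> \<M> (adj E)) / of_nat hdim"
proof -
  have A: "A j \<in> ops" if "j < n" for j
    using assms(1) that by (simp add: kraus_rep_def)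
  have kraus_term: "(\<Sum>p\<in>Basis \<times> Basis. \<Sum>q\<in>Basis \<times> Basis.
      tensor_op (conj_op E) F p q * (T_vec A q * cnj (T_vec A p))) =
      tr (F \<circ> (A \<circ> adj E \<circ> adj A)) / of_nat hdim" if "A \<in> ops" for A
  proof -
    have "(\<Sum>p\<in>Basis \<times> Basis. \<Sum>q\<in>Basis \<times> Basis.
        tensor_op (conj_op E) F p q * (T_vec A q * cnj (T_vec A p))) =
      (\<Sum>x\<in>Basis. \<Sum>y\<in>Basis. \<Sum>x'\<in>Basis. \<Sum>y'\<in>Basis.
        cnj (ip x (E x')) * ip y (F y') * (ip y' (A x') * cnj (ip y (A x)))) / of_nat hdim"
      by (auto simp: sum.cartesian_product' sum_divide_distrib tensor_op_def
          T_vec_mult_cnj ip_conj_op intro!: sum.cong)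
    \<comment> \<open>Summing over \<open>y'\<close> composes \<open>F\<close> with
      \<open>A\<close>; the conjugated entries become entries of adjoints.\<close>
    also have "(\<Sum>x\<in>Basis. \<Sum>y\<in>Basis. \<Sum>x'\<in>Basis. \<Sum>y'\<in>Basis.
        cnj (ip x (E x')) * ip y (F y') * (ip y' (A x') * cnj (ip y (A x)))) =
      (\<Sum>x\<in>Basis. \<Sum>y\<in>Basis. \<Sum>x'\<in>Basis. ip x' (adj E x) * ip y (F (A x')) * ip x (adj A y))"
      using assms that
      by (intro sum.cong refl)
        (simp add: ip_comp[OF assms(3), where B = A] ip_adj_right sum_distrib_left
          sum_distrib_right ip_commute[of "A _" _] ip_commute[of "E _" _] mult_ac)
    \<comment> \<open>Summing over \<open>x'\<close> composes with \<open>adj E\<close>. The two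
      sums that remain form a trace.\<close>
    also have "\<dots> = (\<Sum>x\<in>Basis. \<Sum>y\<in>Basis. ip y (F (A (adj E x))) * ip x (adj A y))"
      using assms that
      by (intro sum.cong refl)
        (simp add: ip_comp[OF ops_comp[OF assms(3) that], where B = "adj E", simplified]
          sum_distrib_left mult_ac)
    also have "\<dots> = tr ((F \<circ> A \<circ> adj E) \<circ> adj A)"
      using assms that
      by (subst tr_comp) (auto intro!: ops_comp adj_ops sum.swap)
    finally show ?thesis
      by (simp add: o_assoc)
  qed
  have "tensor_tr_prod (tensor_op (conj_op E) F) (choi \<M>) =
    (\<Sum>j<n. \<Sum>p\<in>Basis \<times> Basis. \<Sum>q\<in>Basis \<times> Basis.
      tensor_op (conj_op E) F p q * (T_vec (A j) q * cnj (T_vec (A j) p)))"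
    unfolding tensor_tr_prod_def choi_eq[OF assms(1)] sum_fun_apply sum_distrib_left
    by (simp only: sum.swap[where B = "{..<n}"])
  also have "\<dots> = (\<Sum>j<n. tr (F \<circ> (A j \<circ> adj E \<circ> adj (A j)))) / of_nat hdim"
    by (simp add: kraus_term A sum_divide_distrib)
  also have "\<dots> = tr (F \<circ> \<M> (adj E)) / of_nat hdim"
    using assms adj_ops[OF assms(2)] by (simp add: kraus_rep_def comp_sum_left tr_sum)
  finally show ?thesis .
qed

section \<open>Existence and uniqueness of the process matrix\<close>

lemma op_independentD:
  assumes "op.independent \<E>" "finite \<E>" "(\<Sum>E\<in>\<E>. op_scale (c E) E) = 0" "E \<in> \<E>"
  shows "c E = 0"
  using assms op.dependent_finite by blast

lemma process_matrix_exists: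
  assumes "kraus_rep \<M> n A" "finite \<E>" "op.span \<E> = ops"
  shows "\<exists>\<chi>. (\<forall>E E'. \<not> (E \<in> \<E> \<and> E' \<in> \<E>) \<longrightarrow> \<chi> E E' = 0) \<and>
    (\<forall>\<rho>\<in>ops. \<M> \<rho> = (\<Sum>E\<in>\<E>. \<Sum>E'\<in>\<E>. op_scale (\<chi> E E') (adj E' \<circ> \<rho> \<circ> E)))"
proof -
  have A: "A j \<in> ops" if "j < n" for j
    using assms(1) that by (simp add: kraus_rep_def)
  have E: "E \<in> ops" if "E \<in> \<E>" for E
    using assms(3) op.span_base that by blast
  \<comment> \<open>The process form has plain elements of the error basis on the right of
    \<open>\<rho>\<close>, where a Kraus term has \<open>adj (A j)\<close>. So the adjoint is
    expanded first, and taking adjoints yields the left factor.\<close>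
  have "\<exists>c. adj (A j) = (\<Sum>E\<in>\<E>. op_scale (c E) E)" if "j < n" for j
    using adj_ops[OF A[OF that]] op.span_finite[OF assms(2)] assms(3) by auto
  then obtain c where c: "adj (A j) = (\<Sum>E\<in>\<E>. op_scale (c j E) E)" if "j < n" for j
    by metis
  have c': "A j = (\<Sum>E\<in>\<E>. op_scale (cnj (c j E)) (adj E))" if "j < n" for j
    using adj_sum_op_scale[of \<E> "\<lambda>E. E" "c j"] E adj_adj[OF A[OF that]] c[OF that] by simp
  \<comment> \<open>Coefficients from multiplying out both expansions. The value 0 off the error
    basis is what singles out one total function.\<close>
  define \<chi> where "\<chi> E E' = (if E \<in> \<E> \<and> E' \<in> \<E> then \<Sum>j<n. c j E * cnj (c j E') else 0)"
    for E E'
  have "\<M> \<rho> = (\<Sum>E\<in>\<E>. \<Sum>E'\<in>\<E>. op_scale (\<chi> E E') (adj E' \<circ> \<rho> \<circ> E))" if "\<rho> \<in> ops" for \<rho>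
  proof
    fix v
    have "\<M> \<rho> v = (\<Sum>j<n. A j (\<rho> (adj (A j) v)))"
      using assms(1) that by (simp add: kraus_rep_def sum_fun_apply)
    also have "\<dots> = (\<Sum>j<n. \<Sum>E\<in>\<E>. \<Sum>E'\<in>\<E>. scale (c j E * cnj (c j E')) (adj E' (\<rho> (E v))))"
    proof (intro sum.cong refl)
      fix j assume "j \<in> {..<n}"
      then have j: "j < n" by simp
      have "A j (\<rho> (adj (A j) v)) = (\<Sum>E\<in>\<E>. scale (c j E) (A j (\<rho> (E v))))"
        by (simp add: c[OF j] sum_fun_apply op_scale_apply ops_sum[OF that] ops_scale[OF that]
            ops_sum[OF A[OF j]] ops_scale[OF A[OF j]])
      also have "\<dots> = (\<Sum>E\<in>\<E>. \<Sum>E'\<in>\<E>. scale (c j E * cnj (c j E')) (adj E' (\<rho> (E v))))"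
        by (subst c'[OF j]) (simp add: sum_fun_apply op_scale_apply scale_sum_right)
      finally show "A j (\<rho> (adj (A j) v)) = \<dots>" .
    qed
    also have "\<dots> = (\<Sum>E\<in>\<E>. \<Sum>E'\<in>\<E>. \<Sum>j<n. scale (c j E * cnj (c j E')) (adj E' (\<rho> (E v))))"
      by (subst sum.swap, rule sum.cong[OF refl], rule sum.swap)
    finally show "\<M> \<rho> v = (\<Sum>E\<in>\<E>. \<Sum>E'\<in>\<E>. op_scale (\<chi> E E') (adj E' \<circ> \<rho> \<circ> E)) v"
      by (simp add: sum_fun_apply op_scale_apply \<chi>_def scale_sum_left cong: sum.cong)
  qed
  then show ?thesis
    by (intro exI[of _ \<chi>]) (auto simp: \<chi>_def)
qed

text \<open>Rank-one inputs separate the left from the right factor, so independence of the error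
  basis applies twice: first to the right factors, then, after conjugation, to the left
  ones.\<close>

lemma process_coeffs_eq_0:
  assumes "op.independent \<E>" "\<E> \<subseteq> ops"
    and "\<And>\<rho>. \<rho> \<in> ops \<Longrightarrow> (\<Sum>E\<in>\<E>. \<Sum>E'\<in>\<E>. op_scale (\<delta> E E') (adj E' \<circ> \<rho> \<circ> E)) = 0"
    and "E \<in> \<E>" "E' \<in> \<E>"
  shows "\<delta> E E' = 0"
proof -
  have fin: "finite \<E>"
    using assms(1,2) by (rule independent_ops_finite)
  have ops: "F \<in> ops" if "F \<in> \<E>" for F
    using assms(2) that by blast
  have zero: "0 \<in> ops"
    by (rule opsI) auto
  have vanish: "(\<Sum>E\<in>\<E>. (\<Sum>E'\<in>\<E>. \<delta> E E' * ip x (adj E' u)) * ip v (E y)) = 0" for x u v y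
  proof -
    have "(\<Sum>E\<in>\<E>. (\<Sum>E'\<in>\<E>. \<delta> E E' * ip x (adj E' u)) * ip v (E y)) =
        ip x ((\<Sum>E\<in>\<E>. \<Sum>E'\<in>\<E>. op_scale (\<delta> E E') (adj E' \<circ> ketbra u v \<circ> E)) y)"
      unfolding sum_fun_apply op_scale_apply ip_sum_right ip_scale_right sum_distrib_right
      by (intro sum.cong refl) (simp only: ip_ketbra adj_ops ops mult.assoc)
    then show ?thesis
      by (simp add: assms(3)[OF ketbra_ops])
  qed
  \<comment> \<open>For fixed \<open>x\<close> and \<open>u\<close>, letting \<open>v\<close> and
    \<open>y\<close> vary in \<open>vanish\<close> shows that the combination of the right factors
    with these coefficients is the zero operator.\<close>
  have row: "(\<Sum>E'\<in>\<E>. \<delta> E E' * ip x (adj E' u)) = 0" for x u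
  proof -
    have "(\<Sum>E\<in>\<E>. op_scale (\<Sum>E'\<in>\<E>. \<delta> E E' * ip x (adj E' u)) E) = 0"
    proof (rule ops_eqI)
      show "ip v ((\<Sum>E\<in>\<E>. op_scale (\<Sum>E'\<in>\<E>. \<delta> E E' * ip x (adj E' u)) E) y) =
          ip v ((0 :: 'h \<Rightarrow> 'h) y)" for v y
        using vanish[of x u v y] by (simp add: sum_fun_apply op_scale_apply ip_sum_right ip_scale_right)
    qed (simp_all add: sum_op_scale_ops ops zero)
    then show ?thesis
      using op_independentD[OF assms(1) fin _ assms(4),
          of "\<lambda>E. \<Sum>E'\<in>\<E>. \<delta> E E' * ip x (adj E' u)"] by simp
  qed
  \<comment> \<open>Its entries are the conjugates of the sums in \<open>row\<close>. Conjugating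
    trades the adjoints for the elements themselves, whose independence is assumed.\<close>
  have "(\<Sum>E'\<in>\<E>. op_scale (cnj (\<delta> E E')) E') = 0"
  proof (rule ops_eqI)
    show "ip u ((\<Sum>E'\<in>\<E>. op_scale (cnj (\<delta> E E')) E') x) = ip u ((0 :: 'h \<Rightarrow> 'h) x)" for u x
    proof -
      have "ip u ((\<Sum>E'\<in>\<E>. op_scale (cnj (\<delta> E E')) E') x) =
          (\<Sum>E'\<in>\<E>. cnj (\<delta> E E' * ip x (adj E' u)))"
        unfolding sum_fun_apply op_scale_apply ip_sum_right ip_scale_right
        by (intro sum.cong refl) (simp add: ip_adj_right ops, metis ip_commute)
      also have "\<dots> = cnj (\<Sum>E'\<in>\<E>. \<delta> E E' * ip x (adj E' u))"
        by simp
      finally show ?thesis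
        by (simp only: row) simp
    qed
  qed (simp_all add: sum_op_scale_ops ops zero)
  then have "cnj (\<delta> E E') = 0"
    by (rule op_independentD[OF assms(1) fin _ assms(5)])
  then show ?thesis
    by simp
qed

lemma process_matrix_expansion:
  assumes "kraus_rep \<M> n A" "op.independent \<E>" "op.span \<E> = ops" "\<rho> \<in> ops"
  shows "\<M> \<rho> = (\<Sum>E\<in>\<E>. \<Sum>E'\<in>\<E>. op_scale (process_matrix \<E> \<M> E E') (adj E' \<circ> \<rho> \<circ> E))"
proof -
  let ?P = "\<lambda>\<chi>. (\<forall>E E'. \<not> (E \<in> \<E> \<and> E' \<in> \<E>) \<longrightarrow> \<chi> E E' = 0) \<and>
    (\<forall>\<rho>\<in>ops. \<M> \<rho> = (\<Sum>E\<in>\<E>. \<Sum>E'\<in>\<E>. op_scale (\<chi> E E') (adj E' \<circ> \<rho> \<circ> E)))"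
  have sub: "\<E> \<subseteq> ops"
    using assms(3) op.span_superset by blast
  have "\<exists>\<chi>. ?P \<chi>"
    using assms independent_ops_finite[OF assms(2) sub] by (intro process_matrix_exists)
  moreover have "\<chi> = \<chi>'" if \<chi>: "?P \<chi>" and \<chi>': "?P \<chi>'" for \<chi> \<chi>'
  proof (intro ext)
    fix E E'
    show "\<chi> E E' = \<chi>' E E'"
    proof (cases "E \<in> \<E> \<and> E' \<in> \<E>")
      case True
      \<comment> \<open>The difference of two solutions represents the zero map, so its coefficients
        vanish.\<close>
      have "(\<Sum>E\<in>\<E>. \<Sum>E'\<in>\<E>. op_scale (\<chi> E E' - \<chi>' E E') (adj E' \<circ> \<rho> \<circ> E)) = \<M> \<rho> - \<M> \<rho>"
        if "\<rho> \<in> ops" for \<rho>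
      proof -
        have "\<M> \<rho> = (\<Sum>E\<in>\<E>. \<Sum>E'\<in>\<E>. op_scale (\<chi> E E') (adj E' \<circ> \<rho> \<circ> E))"
          "\<M> \<rho> = (\<Sum>E\<in>\<E>. \<Sum>E'\<in>\<E>. op_scale (\<chi>' E E') (adj E' \<circ> \<rho> \<circ> E))"
          using \<chi> \<chi>' that by blast+
        from this[symmetric] show ?thesis
          by (simp only: op.scale_left_diff_distrib sum_subtractf)
      qed
      then show ?thesis
        using process_coeffs_eq_0[OF assms(2) sub, of "\<lambda>E E'. \<chi> E E' - \<chi>' E E'" E E'] True
        by simp
    qed (use \<chi> \<chi>' in metis)
  qed
  ultimately have "\<exists>!\<chi>. ?P \<chi>"
    by blast
  then have "?P (process_matrix \<E> \<M>)"
    unfolding process_matrix_def by (rule theI')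
  then show ?thesis
    using assms(4) by blast
qed

section \<open>The MacWilliams transform and the identity\<close>

lemma macwilliams_unit_apply:
  assumes "finite \<E>"
  shows "macwilliams_unit \<E> E E' F F' = (if F \<in> \<E> \<and> F' \<in> \<E>
    then tr (adj F \<circ> E \<circ> F' \<circ> adj E') / of_nat hdim ^ 2 else 0)"
  unfolding macwilliams_unit_def mat_scale_def[of "1 / _"] sum_mat_scale_mat_unit[OF assms]
  by simp

lemma macwilliams_apply:
  assumes "finite \<E>"
  shows "macwilliams \<E> X F F' = (if F \<in> \<E> \<and> F' \<in> \<E>
    then (\<Sum>E\<in>\<E>. \<Sum>E'\<in>\<E>. X E E' * tr (adj F \<circ> E \<circ> F' \<circ> adj E')) / of_nat hdim ^ 2 else 0)"
  by (auto simp: macwilliams_def sum_fun_apply mat_scale_def macwilliams_unit_apply[OF assms]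
      sum_divide_distrib)

lemma circuit_tensor_eq_macwilliams:
  assumes "error_basis \<E>" "quantum_channel \<M>"
  shows "circuit_tensor \<E> \<M> = mat_scale (of_nat hdim) (macwilliams \<E> (process_matrix \<E> \<M>))"
proof (intro ext)
  fix F F'
  obtain n A where kraus: "kraus_rep \<M> n A"
    using assms(2) by (auto simp: quantum_channel_def)
  have indep: "op.independent \<E>" and span: "op.span \<E> = ops"
    using assms(1) by (auto simp: error_basis_def)
  then have sub: "\<E> \<subseteq> ops"
    using op.span_superset by blast
  then have fin: "finite \<E>"
    using indep independent_ops_finite by blast
  let ?\<chi> = "process_matrix \<E> \<M>"
  show "circuit_tensor \<E> \<M> F F' = mat_scale (of_nat hdim) (macwilliams \<E> ?\<chi>) F F'"
  proof (cases "F \<in> \<E> \<and> F' \<in> \<E>")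
    case True
    then have F: "F \<in> ops" "F' \<in> ops"
      using sub by auto
    have "tr (F' \<circ> \<M> (adj F)) =
        (\<Sum>E\<in>\<E>. \<Sum>E'\<in>\<E>. ?\<chi> E E' * tr (F' \<circ> (adj E' \<circ> adj F \<circ> E)))"
      by (subst process_matrix_expansion[OF kraus indep span adj_ops[OF F(1)]])
        (simp add: comp_sum_left comp_op_scale F tr_sum tr_op_scale)
    \<comment> \<open>Rotating the block \<open>F' \<circ> adj E'\<close> to the end under the trace
      produces the kernel of the transform.\<close>
    also have "\<dots> = (\<Sum>E\<in>\<E>. \<Sum>E'\<in>\<E>. ?\<chi> E E' * tr (adj F \<circ> E \<circ> F' \<circ> adj E'))"
    proof (intro sum.cong refl arg_cong2[where f = "(*)"])
      fix E E' assume "E \<in> \<E>" "E' \<in> \<E>"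
      then show "tr (F' \<circ> (adj E' \<circ> adj F \<circ> E)) = tr (adj F \<circ> E \<circ> F' \<circ> adj E')"
        using tr_cyclic[of "F' \<circ> adj E'" "adj F \<circ> E"] sub F
        by (auto simp: ops_comp adj_ops o_assoc subset_iff)
    qed
    \<comment> \<open>The circuit tensor carries \<open>1 / hdim\<close> and the transform
      \<open>1 / hdim ^ 2\<close>, which accounts for the factor \<open>hdim\<close>.\<close>
    finally show ?thesis
      using True
      by (simp add: circuit_tensor_def sum_mat_scale_mat_unit[OF fin] mat_scale_def[of "of_nat _"]
          macwilliams_apply[OF fin] tensor_tr_prod_choi[OF kraus F] power2_eq_square)
  qed (auto simp: circuit_tensor_def sum_mat_scale_mat_unit[OF fin] mat_scale_def[of "of_nat _"]
          macwilliams_apply[OF fin])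
qed

end

theorem theorem53:
  fixes scale :: "complex \<Rightarrow> 'h::ab_group_add \<Rightarrow> 'h"
    and Basis :: "'h set"
    and ip :: "'h \<Rightarrow> 'h \<Rightarrow> complex"
    and \<E> :: "('h \<Rightarrow> 'h) set"
    and \<M> :: "('h \<Rightarrow> 'h) \<Rightarrow> ('h \<Rightarrow> 'h)"
  assumes "fd_hilbert scale Basis ip"
    and "fd_hilbert.error_basis scale Basis ip \<E>"
    and "fd_hilbert.quantum_channel scale ip \<M>"
  shows "fd_hilbert.circuit_tensor scale Basis ip \<E> \<M> =
    mat_scale (of_nat (vector_space.dim scale UNIV))
      (fd_hilbert.macwilliams scale Basis ip \<E> (fd_hilbert.process_matrix scale ip \<E> \<M>))"
  using assms by (rule fd_hilbert.circuit_tensor_eq_macwilliams)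

end
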